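(* Let $\mathcal{F}$ be a non-degenerate pencil of conics in $\mathbb{C}P^2$ and let $\Gamma_1,\Gamma_2,\Gamma_3,\Gamma_4$ be four conics in $\mathcal{F}$. Let $\mathcal{C}$ be a conic passing through two base points of the pencil of conics $\mathcal{F}$. The intersection points of $\mathcal{C}$ with $\Gamma_i$, other than the two base points, are denoted by $M_i$ and $N_i$ ($i=1,2,3,4$). Then the lines $M_iN_i$ are concurrent and $$(\Gamma_1,\Gamma_2,\Gamma_3,\Gamma_4)=(M_1N_1,M_2N_2,M_3N_3,M_4N_4).$$
   Context: We work in $\mathbb{C}P^2$. Let $Q(\mathbb{C}^3)$ denote the space of quadratic forms on $\mathbb{C}^3$; up to scalar, these are considered as conics (possibly degenerate). A pencil of conics is a line in the projective space $\mathbb{P}(Q(\mathbb{C}^3))$: the pencil generated by two conics with equations $E_1=0$ and $E_2=0$ consists of all conics with equation $\lambda E_1+\mu E_2=0$. The pencil is non-degenerate if two conics generating it meet in four distinct points, called the base points of the pencil; a conic belongs to the pencil if and only if it passes through the four base points. The cross ratio of four points on a line is, in terms of a coordinate on the line, $(A,B,C,D)=\frac{(A-C)(B-D)}{(B-C)(A-D)}$. The cross ratio of four concurrent lines is the cross ratio of their intersection points with any line not passing through their common point. The cross ratio $(\Gamma_1,\Gamma_2,\Gamma_3,\Gamma_4)$ of four conics in a pencil is their cross ratio as points of the projective line in $\mathbb{P}(Q(\mathbb{C}^3))$ which is the pencil.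
   Formalization: The cross-ratio equality is stated for a conic C not in the pencil and not containing the line through the two base points (otherwise the lines M_iN_i all coincide); M_i, N_i are taken to be distinct points, different from the two base points. *)

theory Defs
  imports "HOL-Analysis.Analysis" "HOL-Library.Function_Algebras"
begin

text \<open>
  A point of the projective space of a vector space is a one-dimensional subspace, that is, the
  span of a nonzero vector.
\<close>

locale projective_geometry =
  vector_space scale for scale :: "'a::field \<Rightarrow> 'b::ab_group_add \<Rightarrow> 'b" (infixr "\<cdot>" 75)
begin

definition proj_space :: "'b set \<Rightarrow> 'b set set"
  where "proj_space W = {span {v} | v. v \<in> W \<and> v \<noteq> 0}"

definition proj_line :: "'b set \<Rightarrow> 'b set \<Rightarrow> 'b set set"
  where "proj_line A B = proj_space (span (A \<union> B))"

definition is_proj_line :: "'b set set \<Rightarrow> bool"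
  where "is_proj_line L \<longleftrightarrow>
    (\<exists>A\<in>proj_space UNIV. \<exists>B\<in>proj_space UNIV. A \<noteq> B \<and> L = proj_line A B)"

text \<open>
  Linearly independent vectors \<open>u\<close> and \<open>v\<close> give the coordinate \<open>t\<close> of the point spanned by
  \<open>t u + v\<close> on the projective line through \<open>u\<close> and \<open>v\<close>; the point spanned by \<open>u\<close> is at
  infinity. Over an infinite field any four points of a line are finite in some coordinate, and by
  \<open>cross_ratio_eq\<close> below the value does not depend on the coordinate. As \<open>x / 0 = 0\<close>, a cross
  ratio with vanishing denominator is 0.
\<close>

definition cross_ratio :: "'b set \<Rightarrow> 'b set \<Rightarrow> 'b set \<Rightarrow> 'b set \<Rightarrow> 'a"
  where "cross_ratio A B C D = (THE k. \<exists>u v a b c d.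
    u \<noteq> v \<and> independent {u, v} \<and>
    A = span {a \<cdot> u + v} \<and> B = span {b \<cdot> u + v} \<and>
    C = span {c \<cdot> u + v} \<and> D = span {d \<cdot> u + v} \<and>
    k = ((a - c) * (b - d)) / ((b - c) * (a - d)))"

lemma independent_pair_coeffs:
  assumes "u \<noteq> v" "independent {u, v}" "x \<cdot> u + y \<cdot> v = 0"
  shows "x = 0 \<and> y = 0"
proof -
  let ?f = "\<lambda>w. if w = u then x else y"
  have "(\<Sum>w\<in>{u, v}. ?f w \<cdot> w) = 0"
    using assms(1,3) by simp
  then have "?f w = 0" if "w \<in> {u, v}" for w
    using independentD[OF assms(2) _ subset_refl _ that, of ?f] by simp
  from this[of u] this[of v] show ?thesis
    using assms(1) by simp
qed

lemma independent_pair_eq: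
  assumes "u \<noteq> v" "independent {u, v}" "x \<cdot> u + y \<cdot> v = x' \<cdot> u + y' \<cdot> v"
  shows "x = x' \<and> y = y'"
proof -
  have "(x - x') \<cdot> u + (y - y') \<cdot> v = 0"
    using assms(3) by (simp add: algebra_simps)
  then show ?thesis
    using independent_pair_coeffs[OF assms(1,2)] by fastforce
qed

lemma cross_ratio_coordinate_change:
  assumes uv: "u \<noteq> v" "independent {u, v}" and uv': "u' \<noteq> v'" "independent {u', v'}"
    and eq: "\<And>i. i < (4::nat) \<Longrightarrow> span {t i \<cdot> u + v} = span {t' i \<cdot> u' + v'}"
  shows "((t 0 - t 2) * (t 1 - t 3)) / ((t 1 - t 2) * (t 0 - t 3)) =
    ((t' 0 - t' 2) * (t' 1 - t' 3)) / ((t' 1 - t' 2) * (t' 0 - t' 3))"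
proof -
  have "\<exists>r. t i \<cdot> u + v = r \<cdot> (t' i \<cdot> u' + v')" if "i < 4" for i
  proof -
    have "t i \<cdot> u + v \<in> span {t' i \<cdot> u' + v'}"
      using span_base[of "t i \<cdot> u + v" "{t i \<cdot> u + v}"] eq[OF that] by simp
    then show ?thesis
      unfolding span_singleton by (rule rangeE) (rule exI)
  qed
  then have "\<forall>i. \<exists>r. i < 4 \<longrightarrow> t i \<cdot> u + v = r \<cdot> (t' i \<cdot> u' + v')"
    by blast
  then obtain r where r: "\<And>i. i < 4 \<Longrightarrow> t i \<cdot> u + v = r i \<cdot> (t' i \<cdot> u' + v')"
    using choice[of "\<lambda>i r. i < 4 \<longrightarrow> t i \<cdot> u + v = r \<cdot> (t' i \<cdot> u' + v')"] by blast
  have nz: "t i \<cdot> u + v \<noteq> 0" for i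
    using independent_pair_coeffs[OF uv, of "t i" 1] by auto
  have r0: "r i \<noteq> 0" if "i < 4" for i
    using r[OF that] nz[of i] by auto
  have same: "t' i = t' j" if "i < 4" "j < 4" "t i = t j" for i j
  proof -
    have "(r i * t' i) \<cdot> u' + r i \<cdot> v' = (r j * t' j) \<cdot> u' + r j \<cdot> v'"
      using r[OF that(1)] r[OF that(2)] that(3) by (simp add: scale_right_distrib)
    then show ?thesis
      using independent_pair_eq[OF uv'] r0[OF that(1)] by fastforce
  qed
  show ?thesis
  proof (cases "\<forall>i<4. t i = t 0")
    case True
    have "t 2 = t 0" "t 1 = t 0" "t 3 = t 0"
      using True[rule_format, of 2] True[rule_format, of 1] True[rule_format, of 3]
      by simp_all
    moreover have "t' 2 = t' 0" "t' 1 = t' 0" "t' 3 = t' 0"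
      using same[of 2 0] same[of 1 0] same[of 3 0] calculation by simp_all
    ultimately show ?thesis by simp
  next
    case False
    then obtain m where m: "m < 4" "t m \<noteq> t 0" by blast
    let ?e = "inverse (t m - t 0)"
    define \<alpha> \<beta> where "\<alpha> = ?e * (r m * t' m - r 0 * t' 0)" and "\<beta> = ?e * (r m - r 0)"
    have "(t m - t 0) \<cdot> u = (t m \<cdot> u + v) - (t 0 \<cdot> u + v)"
      by (simp add: algebra_simps)
    also have "\<dots> = (r m * t' m - r 0 * t' 0) \<cdot> u' + (r m - r 0) \<cdot> v'"
      using r[OF m(1)] r[of 0] by (simp add: algebra_simps)
    finally have "?e \<cdot> ((t m - t 0) \<cdot> u) =
        ?e \<cdot> ((r m * t' m - r 0 * t' 0) \<cdot> u' + (r m - r 0) \<cdot> v')" by simp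
    then have u: "u = \<alpha> \<cdot> u' + \<beta> \<cdot> v'"
      using m(2) by (simp add: \<alpha>_def \<beta>_def scale_right_distrib)
    define \<gamma> \<delta> where "\<gamma> = r 0 * t' 0 - t 0 * \<alpha>" and "\<delta> = r 0 - t 0 * \<beta>"
    have "v = r 0 \<cdot> (t' 0 \<cdot> u' + v') - t 0 \<cdot> u"
      using r[of 0] by (simp add: algebra_simps)
    then have v: "v = \<gamma> \<cdot> u' + \<delta> \<cdot> v'"
      by (simp add: \<gamma>_def \<delta>_def u algebra_simps)
    have co: "t i * \<alpha> + \<gamma> = r i * t' i \<and> t i * \<beta> + \<delta> = r i" if "i < 4" for i
    proof (rule independent_pair_eq[OF uv'])
      have "(t i * \<alpha> + \<gamma>) \<cdot> u' + (t i * \<beta> + \<delta>) \<cdot> v' =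
          t i \<cdot> (\<alpha> \<cdot> u' + \<beta> \<cdot> v') + (\<gamma> \<cdot> u' + \<delta> \<cdot> v')"
        by (simp add: algebra_simps)
      also have "\<dots> = t i \<cdot> u + v"
        using u v by simp
      also have "\<dots> = (r i * t' i) \<cdot> u' + r i \<cdot> v'"
        using r[OF that] by (simp add: algebra_simps)
      finally show "(t i * \<alpha> + \<gamma>) \<cdot> u' + (t i * \<beta> + \<delta>) \<cdot> v' =
          (r i * t' i) \<cdot> u' + r i \<cdot> v'" .
    qed
    define \<Delta> where "\<Delta> = \<alpha> * \<delta> - \<beta> * \<gamma>"
    have diff: "(t i - t j) * \<Delta> = r i * r j * (t' i - t' j)" if "i < 4" "j < 4" for i j
    proof -
      have "r i * r j * (t' i - t' j) = (r i * t' i) * r j - r i * (r j * t' j)"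
        by (simp add: algebra_simps)
      also have "\<dots> = (t i * \<alpha> + \<gamma>) * (t j * \<beta> + \<delta>) - (t i * \<beta> + \<delta>) * (t j * \<alpha> + \<gamma>)"
        using co[OF that(1)] co[OF that(2)] by simp
      also have "\<dots> = (t i - t j) * \<Delta>"
        by (simp add: \<Delta>_def algebra_simps)
      finally show ?thesis by simp
    qed
    have "\<Delta> \<noteq> 0"
    proof
      assume "\<Delta> = 0"
      then have "t' m = t' 0"
        using diff[OF m(1), of 0] r0 m(1) by simp
      then have "t m \<cdot> u + v = (r m / r 0) \<cdot> (t 0 \<cdot> u + v)"
        using r[OF m(1)] r[of 0] r0[of 0] by simp
      then have "t m \<cdot> u + 1 \<cdot> v = (r m / r 0 * t 0) \<cdot> u + (r m / r 0) \<cdot> v"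
        by (simp add: scale_right_distrib)
      then show False
        using independent_pair_eq[OF uv] m(2) by fastforce
    qed
    then have d: "t i - t j = r i * r j * (t' i - t' j) / \<Delta>" if "i < 4" "j < 4" for i j
      using diff[OF that] by (simp add: field_simps)
    define K where "K = r 0 * r 1 * r 2 * r 3 / (\<Delta> * \<Delta>)"
    have K: "(t i - t j) * (t k - t l) = K * ((t' i - t' j) * (t' k - t' l))"
      if "i < 4" "j < 4" "k < 4" "l < 4" "r i * r j * (r k * r l) = r 0 * r 1 * r 2 * r 3"
      for i j k l
    proof -
      have "(t i - t j) * (t k - t l) =
          (r i * r j * (r k * r l)) * ((t' i - t' j) * (t' k - t' l)) / (\<Delta> * \<Delta>)"
        using d[OF that(1,2)] d[OF that(3,4)] by simp
      then show ?thesis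
        unfolding that(5) by (simp add: K_def)
    qed
    have "K \<noteq> 0"
      using r0 \<open>\<Delta> \<noteq> 0\<close> by (simp add: K_def)
    then show ?thesis
      using K[of 0 2 1 3] K[of 1 2 0 3] by (simp add: mult_ac)
  qed
qed

lemma cross_ratio_eq:
  assumes "u \<noteq> v" "independent {u, v}"
  shows "cross_ratio (span {a \<cdot> u + v}) (span {b \<cdot> u + v})
      (span {c \<cdot> u + v}) (span {d \<cdot> u + v}) = ((a - c) * (b - d)) / ((b - c) * (a - d))"
  unfolding cross_ratio_def
proof (rule the_equality, goal_cases)
  case 1
  show ?case
    using assms by blast
next
  case (2 k)
  then obtain u' v' a' b' c' d' where *: "u' \<noteq> v'" "independent {u', v'}"
      "span {a \<cdot> u + v} = span {a' \<cdot> u' + v'}" "span {b \<cdot> u + v} = span {b' \<cdot> u' + v'}"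
      "span {c \<cdot> u + v} = span {c' \<cdot> u' + v'}" "span {d \<cdot> u + v} = span {d' \<cdot> u' + v'}"
      and k: "k = ((a' - c') * (b' - d')) / ((b' - c') * (a' - d'))"
    by blast
  let ?t = "\<lambda>i::nat. [a, b, c, d] ! i" and ?t' = "\<lambda>i::nat. [a', b', c', d'] ! i"
  have eq: "span {?t i \<cdot> u + v} = span {?t' i \<cdot> u' + v'}" if "i < 4" for i
  proof -
    from that have "i = 0 \<or> i = 1 \<or> i = 2 \<or> i = 3" by linarith
    then show ?thesis
      using *(3-6) by (elim disjE) (simp_all add: numeral_2_eq_2 numeral_3_eq_3)
  qed
  from cross_ratio_coordinate_change[of u v u' v' ?t ?t', OF assms *(1,2) eq]
  show ?case
    by (simp add: k numeral_2_eq_2 numeral_3_eq_3)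
qed

end

global_interpretation cp2: projective_geometry "(*s) :: complex \<Rightarrow> complex ^ 3 \<Rightarrow> complex ^ 3"
  by unfold_locales

abbreviation CP2 :: "(complex ^ 3) set set"
  where "CP2 \<equiv> cp2.proj_space UNIV"

definition concurrent_lines :: "'i set \<Rightarrow> ('i \<Rightarrow> (complex ^ 3) set set) \<Rightarrow> bool"
  where "concurrent_lines I l \<longleftrightarrow> (\<exists>P\<in>CP2. \<forall>i\<in>I. P \<in> l i)"

text \<open>
  The value does not depend on the transversal \<open>L\<close>: projection from \<open>P\<close> between two
  transversals preserves cross ratios.
\<close>

definition lines_cross_ratio ::
    "(complex ^ 3) set set \<Rightarrow> (complex ^ 3) set set \<Rightarrow> (complex ^ 3) set set \<Rightarrow>
      (complex ^ 3) set set \<Rightarrow> complex"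
  where "lines_cross_ratio l1 l2 l3 l4 = (THE k. \<exists>P L A B C D.
    P \<in> l1 \<inter> l2 \<inter> l3 \<inter> l4 \<and> cp2.is_proj_line L \<and> P \<notin> L \<and>
    l1 \<inter> L = {A} \<and> l2 \<inter> L = {B} \<and> l3 \<inter> L = {C} \<and> l4 \<inter> L = {D} \<and>
    k = cp2.cross_ratio A B C D)"

definition quadratic_forms :: "(complex ^ 3 \<Rightarrow> complex) set"
  where "quadratic_forms =
    {q. \<exists>A :: complex ^ 3 ^ 3. \<forall>x. q x = (\<Sum>i\<in>UNIV. \<Sum>j\<in>UNIV. A $ i $ j * x $ i * x $ j)}"

text \<open>Addition of functions is the pointwise one of \<open>Function_Algebras\<close>.\<close>

global_interpretation qf: projective_geometry
  "\<lambda>(c::complex) (q :: complex ^ 3 \<Rightarrow> complex) x. c * q x"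
  by unfold_locales
    (rule ext, simp only: plus_fun_apply distrib_left distrib_right mult.assoc mult_1_left)+

abbreviation conics :: "(complex ^ 3 \<Rightarrow> complex) set set"
  where "conics \<equiv> qf.proj_space quadratic_forms"

definition conic_points :: "(complex ^ 3 \<Rightarrow> complex) set \<Rightarrow> (complex ^ 3) set set"
  where "conic_points \<Gamma> = {P \<in> CP2. \<forall>q\<in>\<Gamma>. \<forall>x\<in>P. q x = 0}"

definition nondegenerate_pencil :: "(complex ^ 3 \<Rightarrow> complex) set set \<Rightarrow> bool"
  where "nondegenerate_pencil F \<longleftrightarrow>
    (\<exists>\<Gamma>\<in>conics. \<exists>\<Gamma>'\<in>conics. \<Gamma> \<noteq> \<Gamma>' \<and> F = qf.proj_line \<Gamma> \<Gamma>' \<and>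
      card (conic_points \<Gamma> \<inter> conic_points \<Gamma>') = 4)"

definition base_points :: "(complex ^ 3 \<Rightarrow> complex) set set \<Rightarrow> (complex ^ 3) set set"
  where "base_points F = (\<Inter>\<Gamma>\<in>F. conic_points \<Gamma>)"

end

theory Submission
  imports Defs
begin

text \<open>
  Let \<open>Z\<close> be an equation of the line \<open>PQ\<close>. On this line every form vanishing at \<open>P\<close> and \<open>Q\<close> is a
  multiple of the equation \<open>c\<close> of \<open>C\<close>, unless \<open>c\<close> vanishes identically there. So every form \<open>f\<close> of the
  pencil can be written \<open>f = k(f) c + Z h(f)\<close> with a scalar \<open>k(f)\<close> and a linear form \<open>h(f)\<close>, both linear
  in \<open>f\<close>. The points \<open>M\<^sub>i\<close> and \<open>N\<^sub>i\<close> lie on \<open>C\<close> and on \<open>\<Gamma>\<^sub>i\<close> but not on \<open>PQ\<close>, hence \<open>M\<^sub>iN\<^sub>i\<close> is the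
  line \<open>h(f\<^sub>i) = 0\<close>. If \<open>C\<close> is not in the pencil, \<open>h\<close> is injective, so these lines belong to the pencil
  of lines given by the image of \<open>h\<close>, and \<open>h\<close> preserves cross ratios. If \<open>C\<close> contains \<open>PQ\<close>, all the
  lines \<open>M\<^sub>iN\<^sub>i\<close> are the residual line of \<open>C\<close>; if \<open>C\<close> is in the pencil, they all join the two remaining
  base points.
\<close>

section \<open>Spans of one or two vectors, and coordinates on projective lines\<close>

context projective_geometry
begin

lemma span_pair: "span {u, v} = {a \<cdot> u + b \<cdot> v | a b. True}"
proof -
  have "x \<in> span {u, v} \<longleftrightarrow> (\<exists>a b. x = a \<cdot> u + b \<cdot> v)" for x
  proof -
    have "x - a \<cdot> u = b \<cdot> v \<longleftrightarrow> x = a \<cdot> u + b \<cdot> v" for a b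
      by (auto simp: algebra_simps)
    then show ?thesis
      by (auto simp: span_insert[of u "{v}"] span_singleton image_iff)
  qed
  then show ?thesis by blast
qed

text \<open>The set \<open>{u, v}\<close> does not record a repetition, hence the separate condition
  \<open>u \<noteq> v\<close>.\<close>

lemma independent_pair_iff:
  "u \<noteq> v \<and> independent {u, v} \<longleftrightarrow> (\<forall>a b. a \<cdot> u + b \<cdot> v = 0 \<longrightarrow> a = 0 \<and> b = 0)" (is "?l \<longleftrightarrow> ?r")
proof
  show "?l \<Longrightarrow> ?r"
    using independent_pair_coeffs by blast
next
  assume r: ?r
  have v: "v \<noteq> 0"
    using r[rule_format, of 0 1] by auto
  have u: "u \<notin> span {v}"
  proof
    assume "u \<in> span {v}"
    then obtain k where "u = k \<cdot> v"
      by (auto simp: span_singleton)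
    then show False
      using r[rule_format, of 1 "- k"] by simp
  qed
  then have "u \<noteq> v"
    using span_base by blast
  then show ?l
    using u v by (simp add: independent_insert)
qed

lemma span_singleton_scale: "c \<noteq> 0 \<Longrightarrow> span {c \<cdot> v} = span {v}"
  using span_image_scale[of "{v}" "\<lambda>_. c"] by simp

lemma span_singleton_eqD:
  assumes "span {u} = span {v}" "u \<noteq> 0"
  obtains c where "c \<noteq> 0" "u = c \<cdot> v"
proof -
  have "u \<in> span {v}"
    using assms(1) span_base[of u "{u}"] by simp
  then show thesis
    using assms(2) that by (auto simp: span_singleton)
qed

lemma independent_if_span_neq:
  assumes "u \<noteq> 0" "v \<noteq> 0" "span {u} \<noteq> span {v}"
  shows "u \<noteq> v" "independent {u, v}"
proof -
  have "u \<notin> span {v}"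
  proof
    assume "u \<in> span {v}"
    then obtain k where "u = k \<cdot> v"
      by (auto simp: span_singleton)
    then show False
      using span_singleton_scale[of k v] assms by auto
  qed
  then show "u \<noteq> v" "independent {u, v}"
    using assms by (auto simp: independent_insert span_base)
qed

text \<open>A vector of \<open>span {u, v}\<close> outside \<open>span {g, h}\<close> would give
  three independent vectors in the span of two.\<close>

lemma span_pair_eq:
  assumes gh: "g \<noteq> h" "independent {g, h}" "g \<in> span {u, v}" "h \<in> span {u, v}"
  shows "span {u, v} = span {g, h}"
proof
  show "span {g, h} \<subseteq> span {u, v}"
    using gh by (intro span_minimal) simp_all
  show "span {u, v} \<subseteq> span {g, h}"
  proof (rule subsetI, rule ccontr)
    fix w assume w: "w \<in> span {u, v}" "w \<notin> span {g, h}"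
    then have "w \<noteq> g" "w \<noteq> h"
      using span_base by blast+
    then have "card {w, g, h} = 3"
      using gh by simp
    moreover have "independent {w, g, h}"
      using w gh independent_insertI by blast
    then have "card {w, g, h} \<le> card {u, v}"
      using independent_span_bound[of "{u, v}" "{w, g, h}"] gh w by simp
    moreover have "card {u, v} \<le> 2"
      by (simp add: card_insert_if)
    ultimately show False by simp
  qed
qed

lemma proj_line_span: "proj_line (span {u}) (span {v}) = {span {w} | w. w \<in> span {u, v} \<and> w \<noteq> 0}"
proof -
  have "span (span {u} \<union> span {v}) = span {u, v}"
  proof (rule span_unique)
    show "span {u} \<union> span {v} \<subseteq> span {u, v}"
      using span_mono[of "{u}" "{u, v}"] span_mono[of "{v}" "{u, v}"] by auto
    show "span {u, v} \<subseteq> T" if "span {u} \<union> span {v} \<subseteq> T" "subspace T" for T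
      using that span_base[of u "{u}"] span_base[of v "{v}"] by (intro span_minimal) auto
  qed simp
  then show ?thesis
    by (simp add: proj_line_def proj_space_def)
qed

lemma span_mem_proj_line_iff:
  assumes "w \<noteq> 0"
  shows "span {w} \<in> proj_line (span {u}) (span {v}) \<longleftrightarrow> w \<in> span {u, v}"
proof
  assume "span {w} \<in> proj_line (span {u}) (span {v})"
  then obtain x where x: "span {w} = span {x}" "x \<in> span {u, v}"
    by (auto simp: proj_line_span)
  from span_singleton_eqD[OF x(1) assms] show "w \<in> span {u, v}"
    using x(2) span_scale by metis
qed (use assms in \<open>auto simp: proj_line_span\<close>)

lemma span_mem_proj_space_UNIV_iff [simp]: "span {w} \<in> proj_space UNIV \<longleftrightarrow> w \<noteq> 0"
proof
  assume "span {w} \<in> proj_space UNIV"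
  then obtain x where "x \<noteq> 0" "span {w} = span {x}"
    by (auto simp: proj_space_def)
  then show "w \<noteq> 0"
    using span_singleton_eqD[of x w] by auto
qed (auto simp: proj_space_def)

text \<open>Comparing the coefficients of \<open>v\<close> forces the factor between proportional
  vectors \<open>s \<cdot> u + v\<close> and \<open>t \<cdot> u + v\<close> to be 1, so distinct
  coordinates give distinct points.\<close>

lemma infinite_line_points:
  assumes "infinite (UNIV :: 'a set)" "u \<noteq> v" "independent {u, v}"
  shows "infinite (range (\<lambda>t. span {t \<cdot> u + v}))"
proof -
  have "inj (\<lambda>t. span {t \<cdot> u + v})"
  proof (rule injI)
    fix s t assume "span {s \<cdot> u + v} = span {t \<cdot> u + v}"
    moreover have "s \<cdot> u + v \<noteq> 0"
      using independent_pair_coeffs[OF assms(2,3), of s 1] by auto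
    ultimately obtain c where "s \<cdot> u + v = c \<cdot> (t \<cdot> u + v)"
      using span_singleton_eqD by blast
    then have "s \<cdot> u + 1 \<cdot> v = (c * t) \<cdot> u + c \<cdot> v"
      by (simp add: algebra_simps)
    then show "s = t"
      using independent_pair_eq[OF assms(2,3)] by fastforce
  qed
  then show ?thesis
    using assms(1) finite_imageD by blast
qed

text \<open>Cross ratios are computed from finite coordinates, so the point at infinity has to be
  moved away from the given points while the line stays the same. An infinite field leaves room for
  this.\<close>

lemma proj_line_common_coordinate:
  assumes inf: "infinite (UNIV :: 'a set)" and uv: "u \<noteq> v" "independent {u, v}"
    and "finite I" and T: "\<And>i. i \<in> I \<Longrightarrow> T i \<in> proj_line (span {u}) (span {v})"
  obtains u' v' t where "u' \<noteq> v'" "independent {u', v'}" "span {u', v'} = span {u, v}"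
    "\<And>i. i \<in> I \<Longrightarrow> T i = span {t i \<cdot> u' + v'}"
proof -
  have "\<exists>a b. T i = span {a \<cdot> u + b \<cdot> v} \<and> a \<cdot> u + b \<cdot> v \<noteq> 0" if "i \<in> I" for i
    using T[OF that] by (auto simp: proj_line_span span_pair)
  then obtain a b where
    ab: "\<And>i. i \<in> I \<Longrightarrow> T i = span {a i \<cdot> u + b i \<cdot> v} \<and> a i \<cdot> u + b i \<cdot> v \<noteq> 0"
    by metis
  \<comment> \<open>With this \<open>s\<close> the new point at infinity, spanned by
    \<open>u - s \<cdot> v\<close>, is none of the \<open>T i\<close>. An index with
    \<open>a i = 0\<close> merely excludes the value 0, by the convention on division.\<close>
  obtain s where s: "s \<notin> (\<lambda>i. - b i / a i) ` I"
    using inf \<open>finite I\<close> ex_new_if_finite finite_imageI by blast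
  have nz: "s * a i + b i \<noteq> 0" if "i \<in> I" for i
  proof
    assume eq: "s * a i + b i = 0"
    show False
    proof (cases "a i = 0")
      case True
      then show ?thesis
        using eq ab[OF that] by simp
    next
      case False
      then have "s = - b i / a i"
        using eq by (simp add: field_simps add_eq_0_iff)
      then show ?thesis
        using s that by blast
    qed
  qed
  define u' where "u' = u - s \<cdot> v"
  define t where "t i = a i / (s * a i + b i)" for i
  show thesis
  proof
    have "u' \<noteq> v \<and> independent {u', v}"
      unfolding independent_pair_iff
    proof (intro allI impI)
      fix x y assume "x \<cdot> u' + y \<cdot> v = 0"
      then have "x \<cdot> u + (y - x * s) \<cdot> v = 0"
        by (simp add: u'_def algebra_simps)
      then show "x = 0 \<and> y = 0"
        using independent_pair_coeffs[OF uv] by fastforce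
    qed
    then show "u' \<noteq> v" "independent {u', v}" by simp_all
    have "u' \<in> span {u, v}"
      unfolding u'_def by (intro span_diff span_scale) (simp_all add: span_base)
    moreover have "u' + s \<cdot> v \<in> span {u', v}"
      by (intro span_add span_scale) (simp_all add: span_base)
    then have "u \<in> span {u', v}"
      by (simp add: u'_def)
    ultimately show "span {u', v} = span {u, v}"
      unfolding span_eq by (simp add: span_base)
    show "T i = span {t i \<cdot> u' + v}" if "i \<in> I" for i
    proof -
      have "a i \<cdot> u + b i \<cdot> v = a i \<cdot> u' + (s * a i + b i) \<cdot> v"
        by (simp add: u'_def algebra_simps)
      also have "\<dots> = (s * a i + b i) \<cdot> (t i \<cdot> u' + v)"
        using nz[OF that] by (simp add: t_def scale_right_distrib)
      finally show ?thesis
        using ab[OF that] nz[OF that] by (simp add: span_singleton_scale)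
    qed
  qed
qed

text \<open>The quotient is 0 / 0, hence 0 by convention. This value is needed for four coinciding
  lines.\<close>

lemma cross_ratio_same:
  assumes "u \<noteq> v" "independent {u, v}"
  shows "cross_ratio (span {v}) (span {v}) (span {v}) (span {v}) = 0"
  using cross_ratio_eq[OF assms, of 0 0 0 0] by simp

end

section \<open>Linear forms in three variables and the lines they define\<close>

interpretation cp2_form: vector_space_pair
  "(*s) :: complex \<Rightarrow> complex ^ 3 \<Rightarrow> complex ^ 3" "(*) :: complex \<Rightarrow> complex \<Rightarrow> complex"
  by unfold_locales

abbreviation linear_form :: "(complex ^ 3 \<Rightarrow> complex) \<Rightarrow> bool"
  where "linear_form g \<equiv> Vector_Spaces.linear (*s) (*) g"

lemma linear_form_simps:
  assumes "linear_form g"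
  shows "g (v + w) = g v + g w" "g (v - w) = g v - g w" "g (a *s v) = a * g v" "g 0 = 0"
  using cp2_form.linear_add[OF assms] cp2_form.linear_diff[OF assms]
    cp2_form.linear_scale[OF assms] cp2_form.linear_0[OF assms] by simp_all

lemma linear_formI:
  assumes "\<And>v w. g (v + w) = g v + g w" "\<And>a v. g (a *s v) = a * g v"
  shows "linear_form g"
  by unfold_locales (use assms in auto)

lemma cp2_ex_notin_span_pair: "\<exists>r :: complex ^ 3. r \<notin> vec.span {p, q}"
proof (rule ccontr)
  assume "\<not> ?thesis"
  then have "vec.span {p, q} = UNIV" by blast
  then have "vec.dim (UNIV :: (complex ^ 3) set) \<le> card {p, q}"
    by (intro vec.dim_le_card) auto
  also have "card {p, q} \<le> 2"
    by (simp add: card_insert_if)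
  finally show False
    by (simp add: card_cart_basis)
qed

text \<open>\<open>X\<close>, \<open>Y\<close>, \<open>Z\<close> are the forms dual to the basis
  \<open>p\<close>, \<open>q\<close>, \<open>r\<close>; in particular \<open>Z\<close> is an
  equation of the line through \<open>p\<close> and \<open>q\<close>.\<close>

lemma cp2_coordinates:
  fixes p q r :: "complex ^ 3"
  assumes pq: "p \<noteq> q" "vec.independent {p, q}" and r: "r \<notin> vec.span {p, q}"
  obtains X Y Z where "linear_form X" "linear_form Y" "linear_form Z"
    "\<And>w. w = X w *s p + Y w *s q + Z w *s r"
    "X p = 1" "X q = 0" "X r = 0" "Y p = 0" "Y q = 1" "Y r = 0" "Z p = 0" "Z q = 0" "Z r = 1"
proof -
  let ?B = "{p, q, r}"
  have "r \<noteq> p" "r \<noteq> q"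
    using r vec.span_base by blast+
  then have ne: "p \<noteq> r" "q \<noteq> r" "p \<noteq> q" "r \<noteq> p" "r \<noteq> q" "q \<noteq> p"
    using pq by auto
  have "vec.independent (insert r {p, q})"
    using pq r vec.independent_insertI by blast
  then have ind: "vec.independent ?B"
    by (simp add: insert_commute)
  have "UNIV \<subseteq> vec.span ?B"
    using ind ne by (intro vec.card_ge_dim_independent) (simp_all add: card_cart_basis)
  then have sp: "vec.span ?B = UNIV" by blast
  let ?R = "vec.representation ?B"
  have lin: "linear_form (\<lambda>w. ?R w b)" for b
    by (rule linear_formI)
      (simp_all add: vec.representation_add[OF ind] vec.representation_scale[OF ind] sp)
  have ex: "w = ?R w p *s p + ?R w q *s q + ?R w r *s r" for w
  proof -
    have "w = (\<Sum>b\<in>?B. ?R w b *s b)"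
      using vec.sum_representation_eq[OF ind, of w ?B] sp by simp
    then show ?thesis
      using ne by (simp add: add.assoc)
  qed
  have b: "?R b = (\<lambda>c. if c = b then 1 else 0)" if "b \<in> ?B" for b
    using vec.representation_basis[OF ind that] .
  have bs: "?R p = (\<lambda>c. if c = p then 1 else 0)" "?R q = (\<lambda>c. if c = q then 1 else 0)"
    "?R r = (\<lambda>c. if c = r then 1 else 0)"
    using b by auto
  show thesis
    by (rule that[OF lin[of p] lin[of q] lin[of r] ex]) (use ne in \<open>simp_all add: bs\<close>)
qed

definition kernel_line :: "(complex ^ 3 \<Rightarrow> complex) \<Rightarrow> (complex ^ 3) set set"
  where "kernel_line g = {vec.span {w} | w. w \<noteq> 0 \<and> g w = 0}"

lemma span_mem_kernel_line_iff:
  assumes "linear_form g"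
  shows "vec.span {w} \<in> kernel_line g \<longleftrightarrow> w \<noteq> 0 \<and> g w = 0"
proof
  assume "vec.span {w} \<in> kernel_line g"
  then obtain x where x: "vec.span {w} = vec.span {x}" "x \<noteq> 0" "g x = 0"
    unfolding kernel_line_def by blast
  then have "w \<noteq> 0"
    using cp2.span_mem_proj_space_UNIV_iff by metis
  from cp2.span_singleton_eqD[OF x(1) this] obtain c where "w = c *s x" .
  then show "w \<noteq> 0 \<and> g w = 0"
    using x \<open>w \<noteq> 0\<close> by (simp add: linear_form_simps[OF assms])
qed (auto simp: kernel_line_def)

text \<open>In the basis \<open>m\<close>, \<open>n\<close>, \<open>s\<close> the form
  \<open>g\<close> is the third coordinate times the nonzero scalar \<open>g s\<close>, so its zeros
  are exactly the combinations of \<open>m\<close> and \<open>n\<close>.\<close>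

lemma proj_line_eq_kernel_line:
  assumes g: "linear_form g" "g s \<noteq> 0"
    and m: "m \<noteq> 0" "g m = 0" and n: "n \<noteq> 0" "g n = 0" and ne: "vec.span {m} \<noteq> vec.span {n}"
  shows "cp2.proj_line (vec.span {m}) (vec.span {n}) = kernel_line g"
proof -
  note ind = cp2.independent_if_span_neq[OF m(1) n(1) ne]
  have sp: "g w = 0" if "w \<in> vec.span {m, n}" for w
    using that m n by (auto simp: cp2.span_pair linear_form_simps[OF g(1)])
  then have "s \<notin> vec.span {m, n}"
    using g by blast
  from cp2_coordinates[OF ind this] obtain X Y Z
    where w: "\<And>w. w = X w *s m + Y w *s n + Z w *s s" by metis
  have "w \<in> vec.span {m, n}" if "g w = 0" for w
  proof -
    have "g w = X w * g m + Y w * g n + Z w * g s"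
      by (subst w[of w]) (simp add: linear_form_simps[OF g(1)])
    then have "Z w = 0"
      using m n g that by simp
    then have "w = X w *s m + Y w *s n"
      using w[of w] by simp
    then show ?thesis
      by (auto simp: cp2.span_pair)
  qed
  with sp have "g w = 0 \<longleftrightarrow> w \<in> vec.span {m, n}" for w by blast
  then show ?thesis
    by (auto simp: cp2.proj_line_span kernel_line_def)
qed

lemma linear_form_combination:
  assumes "linear_form g" "linear_form h"
  shows "linear_form (\<lambda>w. a * g w + b * h w)"
  using assms by (intro linear_formI) (simp_all add: linear_form_simps algebra_simps)

section \<open>Pencils of lines and the cross ratio of their members\<close>

lemma biorthogonal_independent:
  assumes "linear_form g" "linear_form h" "g v = 1" "h v = 0" "g w = 0" "h w = 1"
  shows "w \<noteq> v" "vec.independent {w, v}"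
proof -
  have "w \<noteq> v \<and> vec.independent {w, v}"
    unfolding cp2.independent_pair_iff
  proof (intro allI impI)
    fix a b assume "a *s w + b *s v = 0"
    then have "g (a *s w + b *s v) = 0" "h (a *s w + b *s v) = 0"
      using assms(1,2) by (simp_all add: linear_form_simps)
    then show "a = 0 \<and> b = 0"
      using assms by (simp add: linear_form_simps)
  qed
  then show "w \<noteq> v" "vec.independent {w, v}" by simp_all
qed

text \<open>Elimination yields vectors \<open>v\<close>, \<open>w\<close> dual to the two forms.
  Removing from a vector outside their span its components along them leaves \<open>n\<close>, which
  spans the common point of the lines \<open>g = 0\<close> and \<open>h = 0\<close>.\<close>

lemma biorthogonal_vectors:
  assumes g: "linear_form g" and h: "linear_form h"
    and ind: "\<And>s t. (\<forall>w. s * g w + t * h w = 0) \<Longrightarrow> s = 0 \<and> t = 0"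
  obtains v w n where "g v = 1" "h v = 0" "g w = 0" "h w = 1" "n \<noteq> 0" "g n = 0" "h n = 0"
proof -
  note lin = linear_form_simps[OF g] linear_form_simps[OF h]
  obtain a where a: "g a \<noteq> 0"
    using ind[of 1 0] by auto
  \<comment> \<open>The form \<open>h - (h a / g a) g\<close> vanishes at \<open>a\<close>, but by
    independence not everywhere; \<open>b\<close> is a vector where it does not vanish.\<close>
  obtain b where "- (h a / g a) * g b + 1 * h b \<noteq> 0"
    using ind[of "- (h a / g a)" 1] by (metis zero_neq_one)
  then have b: "h b - (g b / g a) * h a \<noteq> 0"
    by (simp add: mult.commute)
  define D where "D = h b - (g b / g a) * h a"
  define w where "w = (1 / D) *s (b - (g b / g a) *s a)"
  have "h w = 1 / D * D"
    unfolding w_def lin D_def ..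
  then have w: "g w = 0" "h w = 1"
    using a b by (simp_all add: D_def w_def lin)
  define v where "v = (1 / g a) *s a - (h a / g a) *s w"
  have v: "g v = 1" "h v = 0"
    using a w by (simp_all add: v_def lin)
  obtain r where r: "r \<notin> vec.span {v, w}"
    using cp2_ex_notin_span_pair by blast
  have "g r *s v + h r *s w \<in> vec.span {v, w}"
    by (auto simp: cp2.span_pair)
  then have "r - (g r *s v + h r *s w) \<noteq> 0"
    using r by auto
  then show thesis
    using v w by (intro that[of v w "r - (g r *s v + h r *s w)"]) (simp_all add: lin)
qed

text \<open>On a transversal spanned by vectors dual to \<open>g\<close> and \<open>h\<close>, the
  line with parameter \<open>s\<close> cuts out the point with coordinate \<open>- s\<close>. So the
  parameter serves as a coordinate on the pencil of lines and can be compared with the coordinate on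
  the pencil of conics.\<close>

lemma lines_cross_ratio_kernel_lines:
  assumes g: "linear_form g" and h: "linear_form h"
    and ind: "\<And>s t. (\<forall>w. s * g w + t * h w = 0) \<Longrightarrow> s = 0 \<and> t = 0"
  defines "l \<equiv> \<lambda>a. kernel_line (\<lambda>w. a * g w + h w)"
  shows "lines_cross_ratio (l a) (l b) (l c) (l d) = ((a - c) * (b - d)) / ((b - c) * (a - d))"
  unfolding lines_cross_ratio_def
proof (rule the_equality, goal_cases)
  have gh: "linear_form (\<lambda>w. s * g w + h w)" for s
    using linear_form_combination[OF g h, of s 1] by simp
  note lin = linear_form_simps[OF g] linear_form_simps[OF h]
  have l_iff: "vec.span {w} \<in> l s \<longleftrightarrow> w \<noteq> 0 \<and> s * g w + h w = 0" for s w
    unfolding l_def span_mem_kernel_line_iff[OF gh] ..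
  obtain v w n where v: "g v = 1" "h v = 0" and w: "g w = 0" "h w = 1"
    and n: "n \<noteq> 0" "g n = 0" "h n = 0"
    using biorthogonal_vectors[OF g h ind] by metis
  have nz: "e \<noteq> 0" if "g e = 1" for e
    using that by (auto simp: lin)
  note ind_wv = biorthogonal_independent[OF g h v w]
  \<comment> \<open>All four coordinates change sign, which products of two differences do not
    see.\<close>
  have cr: "cp2.cross_ratio (vec.span {(- a) *s w' + v'}) (vec.span {(- b) *s w' + v'})
      (vec.span {(- c) *s w' + v'}) (vec.span {(- d) *s w' + v'}) =
      ((a - c) * (b - d)) / ((b - c) * (a - d))"
    if "w' \<noteq> v'" "vec.independent {w', v'}" for w' v'
  proof -
    have "(- a - - c) * (- b - - d) = (a - c) * (b - d)" "(- b - - c) * (- a - - d) = (b - c) * (a - d)"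
      by (simp_all add: algebra_simps)
    then show ?thesis
      by (simp only: cp2.cross_ratio_eq[OF that])
  qed
  {
    \<comment> \<open>Existence: the line through \<open>w\<close> and \<open>v\<close> is a
      transversal that avoids the common point \<open>n\<close>.\<close>
    case 1
    let ?L = "cp2.proj_line (vec.span {w}) (vec.span {v})"
    have nz0: "v \<noteq> 0" "w \<noteq> 0"
      using v w by (auto simp: lin)
    have "vec.span {w} \<noteq> vec.span {v}"
    proof
      assume "vec.span {w} = vec.span {v}"
      then obtain k where "w = k *s v"
        using cp2.span_singleton_eqD[of w v] nz0 by blast
      then show False
        using v w by (simp add: lin)
    qed
    then have L: "cp2.is_proj_line ?L"
      unfolding cp2.is_proj_line_def using nz0 cp2.span_mem_proj_space_UNIV_iff by blast
    have "n \<notin> vec.span {w, v}"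
    proof
      assume "n \<in> vec.span {w, v}"
      then obtain x y where xy: "n = x *s w + y *s v"
        by (auto simp: cp2.span_pair)
      then have "g n = y" "h n = x"
        using v w by (simp_all add: lin)
      then show False
        using n xy by simp
    qed
    then have nL: "vec.span {n} \<notin> ?L"
      using n by (simp add: cp2.span_mem_proj_line_iff)
    have int: "l s \<inter> ?L = {vec.span {(- s) *s w + v}}" for s
    proof (intro equalityI subsetI)
      fix A assume A: "A \<in> l s \<inter> ?L"
      then obtain e where e: "A = vec.span {e}" "e \<noteq> 0" "e \<in> vec.span {w, v}"
        by (auto simp: cp2.proj_line_span)
      then obtain x y where xy: "e = x *s w + y *s v"
        by (auto simp: cp2.span_pair)
      have "s * g e + h e = 0"
        using A e l_iff by blast
      then have "x = - s * y"
        using v w by (simp add: xy lin add_eq_0_iff)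
      then have e': "e = y *s ((- s) *s w + v)"
        by (simp add: xy vec.scale_right_distrib mult.commute)
      then have "y \<noteq> 0"
        using e by auto
      then show "A \<in> {vec.span {(- s) *s w + v}}"
        unfolding e(1) e' using cp2.span_singleton_scale[OF \<open>y \<noteq> 0\<close>] by (simp only: singleton_iff)
    next
      fix A assume "A \<in> {vec.span {(- s) *s w + v}}"
      moreover have "(- s) *s w + v \<noteq> 0"
        using v w by (intro nz) (simp add: lin del: vector_smult_lneg)
      moreover have "(- s) *s w + v \<in> vec.span {w, v}"
        by (intro vec.span_add vec.span_scale) (simp_all add: vec.span_base)
      ultimately show "A \<in> l s \<inter> ?L"
        using v w by (simp add: l_iff cp2.span_mem_proj_line_iff lin del: vector_smult_lneg)
    qed
    have "vec.span {n} \<in> l a \<inter> l b \<inter> l c \<inter> l d"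
      using n by (simp add: l_iff)
    then show ?case
      using L nL int cr[OF ind_wv] by metis
  next
    \<comment> \<open>Uniqueness: any transversal \<open>L\<close> and any common point
      \<open>P\<close> give the same value.\<close>
    case (2 k)
    then obtain P L A B C D where P: "P \<in> l a \<inter> l b \<inter> l c \<inter> l d" and L: "cp2.is_proj_line L" "P \<notin> L"
      and int: "l a \<inter> L = {A}" "l b \<inter> L = {B}" "l c \<inter> L = {C}" "l d \<inter> L = {D}"
      and k: "k = cp2.cross_ratio A B C D"
      by blast
    show ?case
    proof (cases "a = b \<and> a = c \<and> a = d")
      \<comment> \<open>Four equal lines have more than one common point, so nothing is known of
        \<open>P\<close>; but the four points on \<open>L\<close> coincide and both sides are
        0.\<close>
      case True
      then have abcd: "b = a" "c = a" "d = a" by auto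
      then have eq: "B = A" "C = A" "D = A"
        using int by auto
      have "A \<in> l a"
        using int by blast
      then obtain e where e: "A = vec.span {e}" "e \<noteq> 0"
        unfolding l_def kernel_line_def by blast
      obtain r where "r \<notin> vec.span {e, e}"
        using cp2_ex_notin_span_pair by blast
      then have r: "r \<notin> vec.span {e}" by simp
      then have "r \<noteq> e"
        using vec.span_base by blast
      moreover have "vec.independent {r, e}"
        using r e by (intro vec.independent_insertI) (simp_all add: vec.independent_empty)
      ultimately show ?thesis
        using cp2.cross_ratio_same[of r e] unfolding k eq e abcd by simp
    next
      case False
      obtain m where m: "P = vec.span {m}" "m \<noteq> 0"
        using P unfolding l_def kernel_line_def by blast
      have lm: "a * g m + h m = 0" "b * g m + h m = 0" "c * g m + h m = 0" "d * g m + h m = 0"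
        using P m by (simp_all add: l_iff)
      \<comment> \<open>At least two parameters differ, so subtracting the equations forces
        \<open>g\<close>, and then \<open>h\<close>, to vanish at \<open>m\<close>.\<close>
      have "(a - b) * g m = 0" "(a - c) * g m = 0" "(a - d) * g m = 0"
        using lm by (simp_all add: left_diff_distrib eq_neg_iff_add_eq_0[symmetric])
      then have gm: "g m = 0"
        using False by auto
      then have hm: "h m = 0"
        using lm by simp
      obtain p q where pq: "p \<noteq> 0" "q \<noteq> 0" "vec.span {p} \<noteq> vec.span {q}"
        "L = cp2.proj_line (vec.span {p}) (vec.span {q})"
        using L(1) unfolding cp2.is_proj_line_def cp2.proj_space_def by blast
      have "m \<notin> vec.span {p, q}"
        using L m by (simp add: pq cp2.span_mem_proj_line_iff)
      from cp2_coordinates[OF cp2.independent_if_span_neq[OF pq(1-3)] this] obtain X Y Z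
        where co: "\<And>e. e = X e *s p + Y e *s q + Z e *s m" by metis
      \<comment> \<open>\<open>m\<close> is a common zero of \<open>g\<close> and \<open>h\<close>, so biorthogonal vectors may be projected from it to \<open>L\<close>.\<close>
      define v' w' where "v' = v - Z v *s m" and "w' = w - Z w *s m"
      have v': "g v' = 1" "h v' = 0" and w': "g w' = 0" "h w' = 1"
        using v w gm hm by (simp_all add: v'_def w'_def lin)
      have "e - Z e *s m \<in> vec.span {p, q}" for e
      proof -
        have "e - Z e *s m = X e *s p + Y e *s q"
          using co[of e] by (simp add: algebra_simps)
        then show ?thesis
          by (auto simp: cp2.span_pair)
      qed
      then have "v' \<in> vec.span {p, q}" "w' \<in> vec.span {p, q}"
        by (simp_all add: v'_def w'_def)
      then have inL: "(- s) *s w' + v' \<in> vec.span {p, q}" for s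
        by (intro vec.span_add vec.span_scale)
      have "(- s) *s w' + v' \<noteq> 0" for s
        using v' w' by (intro nz) (simp add: lin del: vector_smult_lneg)
      then have "vec.span {(- s) *s w' + v'} \<in> l s \<inter> L" for s
        using inL[of s] v' w'
        by (simp add: l_iff pq cp2.span_mem_proj_line_iff lin del: vector_smult_lneg)
      then have "A = vec.span {(- a) *s w' + v'}" "B = vec.span {(- b) *s w' + v'}"
        "C = vec.span {(- c) *s w' + v'}" "D = vec.span {(- d) *s w' + v'}"
        using int by (metis singletonD)+
      then show ?thesis
        unfolding k using cr[OF biorthogonal_independent[OF g h v' w']] by simp
    qed
  }
qed

section \<open>Quadratic forms and the points of their conics\<close>

text \<open>For a quadratic form this is the associated symmetric bilinear form without the factor
  1/2. If \<open>f\<close> vanishes at \<open>u\<close> and \<open>v\<close>, it decides whether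
  \<open>f\<close> vanishes on the whole line through them.\<close>

definition polar :: "(complex ^ 3 \<Rightarrow> complex) \<Rightarrow> complex ^ 3 \<Rightarrow> complex ^ 3 \<Rightarrow> complex"
  where "polar f u v = f (u + v) - f u - f v"

lemma quadratic_form_expansion:
  assumes "f \<in> quadratic_forms"
  shows "f (a *s u + b *s v + c *s w) = a\<^sup>2 * f u + b\<^sup>2 * f v + c\<^sup>2 * f w +
    a * b * polar f u v + a * c * polar f u w + b * c * polar f v w"
proof -
  obtain A :: "complex ^ 3 ^ 3"
    where A: "\<And>x. f x = (\<Sum>i\<in>UNIV. \<Sum>j\<in>UNIV. A $ i $ j * x $ i * x $ j)"
    using assms unfolding quadratic_forms_def by blast
  \<comment> \<open>The matrix \<open>A\<close> need not be symmetric; \<open>polar f u v\<close> is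
    \<open>B u v + B v u\<close>.\<close>
  define B where "B x y = (\<Sum>i\<in>UNIV. \<Sum>j\<in>UNIV. A $ i $ j * x $ i * y $ j)" for x y :: "complex ^ 3"
  have add: "B (x + x') y = B x y + B x' y" "B y (x + x') = B y x + B y x'" for x x' y
    by (simp_all add: B_def sum.distrib algebra_simps)
  have scale: "B (k *s x) y = k * B x y" "B y (k *s x) = k * B y x" for k x y
    by (simp_all add: B_def sum_distrib_left mult_ac)
  have f: "f x = B x x" for x
    by (simp add: A B_def)
  show ?thesis
    by (simp add: f polar_def add scale power2_eq_square algebra_simps)
qed

lemma quadratic_form_scale:
  assumes "f \<in> quadratic_forms"
  shows "f (a *s u) = a\<^sup>2 * f u"
proof -
  have "f 0 = 0"
    using assms by (auto simp: quadratic_forms_def)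
  then show ?thesis
    using quadratic_form_expansion[OF assms, of a u 0 0 0 0] by (simp add: polar_def)
qed

lemma subspace_quadratic_forms: "qf.subspace quadratic_forms"
proof (rule qf.subspaceI)
  show "0 \<in> quadratic_forms"
    unfolding quadratic_forms_def by (auto intro!: exI[of _ 0])
  show "f + g \<in> quadratic_forms" if fg: "f \<in> quadratic_forms" "g \<in> quadratic_forms" for f g
  proof -
    obtain A B :: "complex ^ 3 ^ 3" where
      "\<And>x. f x = (\<Sum>i\<in>UNIV. \<Sum>j\<in>UNIV. A $ i $ j * x $ i * x $ j)"
      "\<And>x. g x = (\<Sum>i\<in>UNIV. \<Sum>j\<in>UNIV. B $ i $ j * x $ i * x $ j)"
      using fg unfolding quadratic_forms_def by blast
    then have "(f + g) x = (\<Sum>i\<in>UNIV. \<Sum>j\<in>UNIV. (A + B) $ i $ j * x $ i * x $ j)" for x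
      by (simp add: sum.distrib algebra_simps)
    then show ?thesis
      unfolding quadratic_forms_def by blast
  qed
  show "(\<lambda>x. c * f x) \<in> quadratic_forms" if f: "f \<in> quadratic_forms" for c f
  proof -
    obtain A :: "complex ^ 3 ^ 3" where
      "\<And>x. f x = (\<Sum>i\<in>UNIV. \<Sum>j\<in>UNIV. A $ i $ j * x $ i * x $ j)"
      using f unfolding quadratic_forms_def by blast
    then have "c * f x = (\<Sum>i\<in>UNIV. \<Sum>j\<in>UNIV. (\<chi> i j. c * A $ i $ j) $ i $ j * x $ i * x $ j)" for x
      by (simp add: sum_distrib_left mult.assoc)
    then show ?thesis
      unfolding quadratic_forms_def by blast
  qed
qed

text \<open>Homogeneity of \<open>f\<close> makes vanishing independent of the representatives of
  the conic and of the point.\<close>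

lemma span_mem_conic_points_iff:
  assumes "f \<in> quadratic_forms"
  shows "vec.span {w} \<in> conic_points (qf.span {f}) \<longleftrightarrow> w \<noteq> 0 \<and> f w = 0"
proof -
  have "(\<forall>q\<in>qf.span {f}. \<forall>x\<in>vec.span {w}. q x = 0) \<longleftrightarrow> f w = 0"
  proof
    assume "\<forall>q\<in>qf.span {f}. \<forall>x\<in>vec.span {w}. q x = 0"
    moreover have "f \<in> qf.span {f}" "w \<in> vec.span {w}"
      by (simp_all add: qf.span_base vec.span_base)
    ultimately show "f w = 0" by blast
  qed (auto simp: qf.span_singleton vec.span_singleton quadratic_form_scale[OF assms])
  then show ?thesis
    by (auto simp: conic_points_def)
qed

lemma proj_line_subset_conic_points:
  assumes f: "f \<in> quadratic_forms" and pq: "p \<noteq> q" "vec.independent {p, q}"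
    and "f p = 0" "f q = 0" "polar f p q = 0"
  shows "cp2.proj_line (vec.span {p}) (vec.span {q}) \<subseteq> conic_points (qf.span {f})"
proof -
  have "f w = 0" if w: "w \<in> vec.span {p, q}" for w
  proof -
    obtain a b where "w = a *s p + b *s q"
      using w by (auto simp: cp2.span_pair)
    then show ?thesis
      using quadratic_form_expansion[OF f, of a p b q 0 0] assms by simp
  qed
  then show ?thesis
    by (auto simp: cp2.proj_line_span span_mem_conic_points_iff[OF f])
qed

lemma infinite_proj_line:
  fixes p q :: "complex ^ 3"
  assumes "p \<noteq> q" "vec.independent {p, q}"
  shows "infinite (cp2.proj_line (vec.span {p}) (vec.span {q}))"
proof -
  have "range (\<lambda>t. vec.span {t *s p + q}) \<subseteq> cp2.proj_line (vec.span {p}) (vec.span {q})"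
  proof
    fix A assume "A \<in> range (\<lambda>t. vec.span {t *s p + q})"
    then obtain t where t: "A = vec.span {t *s p + q}" by blast
    have "t *s p + q \<noteq> 0"
      using cp2.independent_pair_coeffs[OF assms, of t 1] by auto
    moreover have "t *s p + q \<in> vec.span {p, q}"
      by (intro vec.span_add vec.span_scale) (simp_all add: vec.span_base)
    ultimately show "A \<in> cp2.proj_line (vec.span {p}) (vec.span {q})"
      by (simp add: t cp2.span_mem_proj_line_iff)
  qed
  then show ?thesis
    using cp2.infinite_line_points[OF infinite_UNIV_char_0 assms] finite_subset by blast
qed

text \<open>The grouping separates the value on the line through \<open>p\<close> and
  \<open>q\<close> from a multiple of \<open>c\<close>. Once \<open>a\<close>, \<open>b\<close>,
  \<open>c\<close> are coordinate forms, the cofactor of \<open>c\<close> is a linear form.\<close>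

lemma quadratic_form_two_zeros:
  assumes "f \<in> quadratic_forms" "f p = 0" "f q = 0"
  shows "f (a *s p + b *s q + c *s r) =
    a * b * polar f p q + c * (a * polar f p r + b * polar f q r + c * f r)"
  unfolding quadratic_form_expansion[OF assms(1)]
  by (simp add: assms power2_eq_square algebra_simps)

text \<open>Either the conic contains the line through \<open>p\<close> and \<open>q\<close>, or the
  lines through \<open>p\<close> give infinitely many residual points. As each
  \<open>\<Gamma> i\<close> meets \<open>C\<close> in finitely many points, this will rule out
  \<open>C = \<Gamma> i\<close>.\<close>

lemma infinite_conic_points:
  assumes f: "f \<in> quadratic_forms" and pq: "p \<noteq> q" "vec.independent {p, q}"
    and fp: "f p = 0" and fq: "f q = 0"
  shows "infinite (conic_points (qf.span {f}))"
proof (cases "polar f p q = 0")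
  case True
  show ?thesis
    using proj_line_subset_conic_points[OF f pq fp fq True] infinite_proj_line[OF pq] finite_subset
    by blast
next
  case False
  obtain r where r: "r \<notin> vec.span {p, q}"
    using cp2_ex_notin_span_pair by blast
  from cp2_coordinates[OF pq r] obtain X Y Z where
    Y: "linear_form Y" and Z: "linear_form Z"
    and pqr: "Y p = 0" "Y q = 1" "Y r = 0" "Z p = 0" "Z q = 0" "Z r = 1" by metis
  note lin = linear_form_simps[OF Y] linear_form_simps[OF Z]
  \<comment> \<open>As \<open>f p = 0\<close>, the value of \<open>f\<close> at
    \<open>k p + q + t r\<close> is affine in \<open>k\<close>; \<open>e t\<close> is the
    coefficient of \<open>k\<close>.\<close>
  define e where "e t = polar f p q + t * polar f p r" for t
  \<comment> \<open>The residual intersection point of the conic with the line through \<open>P\<close> and \<open>q + t r\<close>.\<close>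
  define x where "x t = (- (t * (polar f q r + t * f r)) / e t) *s p + 1 *s q + t *s r" for t
  have x: "Y (x t) = 1" "Z (x t) = t" for t
    by (simp_all add: x_def lin pqr del: vec.scale_one vector_smult_lid)
  then have nz: "x t \<noteq> 0" for t
    by (metis lin(4) zero_neq_one)
  have "inj (\<lambda>t. vec.span {x t})"
  proof (rule injI)
    fix s t assume "vec.span {x s} = vec.span {x t}"
    then obtain c where c: "x s = c *s x t"
      using cp2.span_singleton_eqD nz by blast
    then have "c = 1"
      using x lin(3) by (metis mult.right_neutral)
    then show "s = t"
      using c x by (metis vec.scale_one)
  qed
  \<comment> \<open>Since \<open>e 0\<close> is not 0, the affine function \<open>e\<close> has at
    most one zero.\<close>
  moreover have "infinite {t. e t \<noteq> 0}"
  proof -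
    have "t = - polar f p q / polar f p r" if "e t = 0" for t
    proof -
      have "polar f p r \<noteq> 0"
        using False that by (auto simp: e_def)
      then show ?thesis
        using that by (intro eq_divide_imp) (simp_all add: e_def eq_neg_iff_add_eq_0 add.commute)
    qed
    then have "{t. e t = 0} \<subseteq> {- polar f p q / polar f p r}"
      by blast
    then have "finite {t. e t = 0}"
      using finite_subset by blast
    then have "infinite (- {t. e t = 0})"
      using infinite_UNIV_char_0[where 'a = complex] by (simp add: finite_compl)
    then show ?thesis
      by (simp add: Compl_eq)
  qed
  ultimately have "infinite ((\<lambda>t. vec.span {x t}) ` {t. e t \<noteq> 0})"
    using finite_imageD inj_on_subset by blast
  moreover have "f (x t) = 0" if "e t \<noteq> 0" for t
  proof -
    define k where "k = - (t * (polar f q r + t * f r)) / e t"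
    have "f (x t) = k * e t + t * (polar f q r + t * f r)"
      unfolding x_def k_def[symmetric] quadratic_form_two_zeros[OF f fp fq]
      by (simp add: e_def algebra_simps)
    then show ?thesis
      using that by (simp add: k_def)
  qed
  then have "(\<lambda>t. vec.span {x t}) ` {t. e t \<noteq> 0} \<subseteq> conic_points (qf.span {f})"
    using nz by (auto simp: span_mem_conic_points_iff[OF f])
  ultimately show ?thesis
    using finite_subset by blast
qed

section \<open>Base points and the lines cut out on \<open>C\<close> by the pencil\<close>

text \<open>Two distinct members already generate the pencil, so a common zero of their equations is
  a zero of all members.\<close>

lemma base_points_eq_Int:
  assumes F: "F = {qf.span {w} | w. w \<in> qf.span {u, v} \<and> w \<noteq> 0}"
    and q: "qf.span {u, v} \<subseteq> quadratic_forms"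
    and G: "G \<in> F" "H \<in> F" "G \<noteq> H"
  shows "conic_points G \<inter> conic_points H = base_points F"
proof
  obtain g h where g: "G = qf.span {g}" "g \<in> qf.span {u, v}" "g \<noteq> 0"
    and h: "H = qf.span {h}" "h \<in> qf.span {u, v}" "h \<noteq> 0"
    using G F by blast
  have gh: "g \<noteq> h" "qf.independent {g, h}"
    using qf.independent_if_span_neq[of g h] g h G by auto
  note sp = qf.span_pair_eq[OF gh g(2) h(2)]
  show "conic_points G \<inter> conic_points H \<subseteq> base_points F"
  proof
    fix A assume A: "A \<in> conic_points G \<inter> conic_points H"
    then obtain x where x: "A = vec.span {x}" "x \<noteq> 0"
      unfolding conic_points_def cp2.proj_space_def by blast
    have "g x = 0" "h x = 0"
      using A x g h q by (auto simp: span_mem_conic_points_iff)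
    then have "w x = 0" if "w \<in> qf.span {u, v}" for w
      using that unfolding sp by (auto simp: qf.span_pair)
    then show "A \<in> base_points F"
      using x q by (auto simp: base_points_def F span_mem_conic_points_iff)
  qed
  show "base_points F \<subseteq> conic_points G \<inter> conic_points H"
    using G by (auto simp: base_points_def)
qed

text \<open>If \<open>C\<close> is in \<open>F\<close> or contains the line \<open>PQ\<close>, the
  four lines coincide and their cross ratio is 0, whereas four distinct conics have a nonzero one.
  Hence the cross ratios are compared outside these two cases only, while concurrence holds in all
  cases.\<close>

theorem theorem5:
  fixes F :: "(complex ^ 3 \<Rightarrow> complex) set set"
    and \<Gamma> :: "nat \<Rightarrow> (complex ^ 3 \<Rightarrow> complex) set"
    and C :: "(complex ^ 3 \<Rightarrow> complex) set"
    and P Q :: "(complex ^ 3) set"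
    and M N :: "nat \<Rightarrow> (complex ^ 3) set"
  assumes "nondegenerate_pencil F"
    and "\<And>i. i \<in> {1..4} \<Longrightarrow> \<Gamma> i \<in> F"
    and "C \<in> conics"
    and "P \<in> base_points F" "Q \<in> base_points F" "P \<noteq> Q"
    and "P \<in> conic_points C" "Q \<in> conic_points C"
    and "\<And>i. i \<in> {1..4} \<Longrightarrow> M i \<noteq> N i"
    and "\<And>i. i \<in> {1..4} \<Longrightarrow> conic_points C \<inter> conic_points (\<Gamma> i) - {P, Q} = {M i, N i}"
  shows "concurrent_lines {1..4} (\<lambda>i. cp2.proj_line (M i) (N i)) \<and>
    (C \<notin> F \<and> \<not> cp2.proj_line P Q \<subseteq> conic_points C \<longrightarrow>
      qf.cross_ratio (\<Gamma> 1) (\<Gamma> 2) (\<Gamma> 3) (\<Gamma> 4) =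
      lines_cross_ratio (cp2.proj_line (M 1) (N 1)) (cp2.proj_line (M 2) (N 2))
        (cp2.proj_line (M 3) (N 3)) (cp2.proj_line (M 4) (N 4)))"
proof -
  obtain e1 e2 where e: "e1 \<in> quadratic_forms" "e2 \<in> quadratic_forms" "e1 \<noteq> 0" "e2 \<noteq> 0"
    "qf.span {e1} \<noteq> qf.span {e2}" and Fe: "F = qf.proj_line (qf.span {e1}) (qf.span {e2})"
    using assms(1) unfolding nondegenerate_pencil_def qf.proj_space_def by blast
  \<comment> \<open>The generator \<open>u\<close> is none of the four conics, so every
    \<open>\<Gamma> i\<close> has a finite coordinate \<open>t i\<close>.\<close>
  obtain u v t where uv: "u \<noteq> v" "qf.independent {u, v}" "qf.span {u, v} = qf.span {e1, e2}"
    and \<Gamma>_span: "\<And>i. i \<in> {1..4} \<Longrightarrow> \<Gamma> i = qf.span {(\<lambda>x. t i * u x) + v}"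
    using qf.proj_line_common_coordinate[OF infinite_UNIV_char_0
        qf.independent_if_span_neq[OF e(3-5)] finite_atLeastAtMost, of 1 4 \<Gamma>] assms(2)
    unfolding Fe by metis
  have F: "F = {qf.span {w} | w. w \<in> qf.span {u, v} \<and> w \<noteq> 0}"
    unfolding Fe qf.proj_line_span uv ..
  have quad: "qf.span {u, v} \<subseteq> quadratic_forms"
    unfolding uv(3) using e by (intro qf.span_minimal subspace_quadratic_forms) auto
  have u: "u \<in> qf.span {u, v}" "u \<noteq> 0" and v: "v \<in> qf.span {u, v}" "v \<noteq> 0"
    using uv(2) qf.dependent_zero[of "{u, v}"] by (auto simp: qf.span_base)
  obtain c where c: "C = qf.span {c}" "c \<in> quadratic_forms" "c \<noteq> 0"
    using assms(3) unfolding qf.proj_space_def by blast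
  define f where "f i = (\<lambda>x. t i * u x) + v" for i
  have f_apply: "f i x = t i * u x + v x" for i x
    by (simp add: f_def)
  have \<Gamma>: "\<Gamma> i = qf.span {f i}" if "i \<in> {1..4}" for i
    using \<Gamma>_span[OF that] by (simp add: f_def)
  have f_span: "f i \<in> qf.span {u, v}" for i
    using u(1) v(1) unfolding f_def by (intro qf.span_add qf.span_scale)
  then have f_quad: "f i \<in> quadratic_forms" for i
    using quad by blast
  have u_quad: "u \<in> quadratic_forms" and v_quad: "v \<in> quadratic_forms"
    using quad u v by auto
  obtain p q where p: "P = vec.span {p}" "p \<noteq> 0" and q: "Q = vec.span {q}" "q \<noteq> 0"
    using assms(7,8) unfolding conic_points_def cp2.proj_space_def by blast
  note pq = cp2.independent_if_span_neq[of p q, folded p(1) q(1), OF p(2) q(2) assms(6)]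
  have "qf.span {u} \<in> F" "qf.span {v} \<in> F"
    unfolding F using u v by blast+
  then have "P \<in> conic_points (qf.span {u})" "Q \<in> conic_points (qf.span {u})"
    "P \<in> conic_points (qf.span {v})" "Q \<in> conic_points (qf.span {v})"
    using assms(4,5) unfolding base_points_def by blast+
  then have uv0: "u p = 0" "u q = 0" "v p = 0" "v q = 0"
    using p q u_quad v_quad by (simp_all add: span_mem_conic_points_iff)
  then have f0: "f i p = 0" "f i q = 0" for i
    by (simp_all add: f_apply)
  have c0: "c p = 0" "c q = 0"
    using assms(7,8) unfolding c p q by (simp_all add: span_mem_conic_points_iff[OF c(2)])
  have "\<exists>m n. M i = vec.span {m} \<and> N i = vec.span {n} \<and> m \<noteq> 0 \<and> n \<noteq> 0 \<and> c m = 0 \<and> c n = 0 \<and>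
      f i m = 0 \<and> f i n = 0" if i: "i \<in> {1..4}" for i
  proof -
    have mem: "M i \<in> conic_points C" "N i \<in> conic_points C"
      "M i \<in> conic_points (\<Gamma> i)" "N i \<in> conic_points (\<Gamma> i)"
      using assms(10)[OF i] by blast+
    obtain m where m: "M i = vec.span {m}"
      using mem(1) unfolding conic_points_def cp2.proj_space_def by blast
    obtain n where n: "N i = vec.span {n}"
      using mem(2) unfolding conic_points_def cp2.proj_space_def by blast
    show ?thesis
      using mem
      unfolding c(1) \<Gamma>[OF i] m n span_mem_conic_points_iff[OF c(2)] span_mem_conic_points_iff[OF f_quad]
      by blast
  qed
  then obtain m n where *: "\<And>i. i \<in> {1..4} \<Longrightarrow> M i = vec.span {m i} \<and> N i = vec.span {n i} \<and>
      m i \<noteq> 0 \<and> n i \<noteq> 0 \<and> c (m i) = 0 \<and> c (n i) = 0 \<and> f i (m i) = 0 \<and> f i (n i) = 0"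
    by metis
  have mn: "M i = vec.span {m i}" "N i = vec.span {n i}" "m i \<noteq> 0" "n i \<noteq> 0"
    "c (m i) = 0" "c (n i) = 0" "f i (m i) = 0" "f i (n i) = 0" if "i \<in> {1..4}" for i
    using *[OF that] by simp_all
  have MN_PQ: "M i \<noteq> P" "M i \<noteq> Q" "N i \<noteq> P" "N i \<noteq> Q" if "i \<in> {1..4}" for i
  proof -
    have "M i \<in> conic_points C \<inter> conic_points (\<Gamma> i) - {P, Q}"
      "N i \<in> conic_points C \<inter> conic_points (\<Gamma> i) - {P, Q}"
      unfolding assms(10)[OF that] by simp_all
    then show "M i \<noteq> P" "M i \<noteq> Q" "N i \<noteq> P" "N i \<noteq> Q"
      by blast+
  qed
  \<comment> \<open>Finiteness excludes both a common line of \<open>C\<close> and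
    \<open>\<Gamma> i\<close> and the equality \<open>C = \<Gamma> i\<close>.\<close>
  have fin: "finite (conic_points C \<inter> conic_points (\<Gamma> i))" if "i \<in> {1..4}" for i
  proof -
    have "conic_points C \<inter> conic_points (\<Gamma> i) \<subseteq> {P, Q, M i, N i}"
      using assms(10)[OF that] by blast
    then show ?thesis
      using finite_subset by blast
  qed
  obtain r where r: "r \<notin> vec.span {p, q}"
    using cp2_ex_notin_span_pair by blast
  from cp2_coordinates[OF pq r] obtain X Y Z where XYZ: "linear_form X" "linear_form Y" "linear_form Z"
    and co: "\<And>w. w = X w *s p + Y w *s q + Z w *s r"
    by metis
  \<comment> \<open>Every form \<open>a\<close> vanishing at \<open>p\<close> and \<open>q\<close>
    is \<open>polar a p q\<close> times \<open>X Y\<close>, plus \<open>Z\<close> times the linear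
    form \<open>l a\<close>.\<close>
  define l where "l a w = X w * polar a p r + Y w * polar a q r + Z w * a r" for a w
  have l: "linear_form (l a)" for a
    using XYZ by (intro linear_formI) (simp_all add: l_def linear_form_simps algebra_simps)
  have expand: "a w = X w * Y w * polar a p q + Z w * l a w"
    if "a \<in> quadratic_forms" "a p = 0" "a q = 0" for a w
    unfolding l_def by (subst co[of w]) (rule quadratic_form_two_zeros[OF that])
  \<comment> \<open>A conic through \<open>P\<close> and \<open>Q\<close> that does not contain the
    line \<open>PQ\<close> meets it in no further point.\<close>
  have Z_nz: "Z w \<noteq> 0"
    if "a \<in> quadratic_forms" "a p = 0" "a q = 0" "polar a p q \<noteq> 0" "a w = 0" "w \<noteq> 0"
      "vec.span {w} \<noteq> P" "vec.span {w} \<noteq> Q" for a w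
  proof
    assume Z: "Z w = 0"
    then have "X w = 0 \<or> Y w = 0"
      using expand[OF that(1-3), of w] that(4,5) by simp
    then have "w = Y w *s q \<or> w = X w *s p"
      using co[of w] Z by auto
    then show False
      using that(6-8) cp2.span_singleton_scale vec.scale_zero_left unfolding p q by metis
  qed
  show ?thesis
  proof (cases "polar c p q = 0")
    \<comment> \<open>\<open>C\<close> contains \<open>PQ\<close>: its equation is the product of
      \<open>Z\<close> and \<open>l c\<close>, the equation of the residual line.\<close>
    case True
    have PQ: "cp2.proj_line P Q \<subseteq> conic_points C"
      unfolding p q c(1) by (rule proj_line_subset_conic_points[OF c(2) pq c0 True])
    have "c = (\<lambda>w. Z w * l c w)"
      using expand[OF c(2) c0] True by auto
    then obtain s where s: "l c s \<noteq> 0"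
      using c(3) by (metis mult_zero_right zero_fun_apply ext)
    have line: "cp2.proj_line (M i) (N i) = kernel_line (l c)" if i: "i \<in> {1..4}" for i
    proof -
      \<comment> \<open>As \<open>C\<close> contains \<open>PQ\<close>, it is
        \<open>\<Gamma> i\<close> that keeps \<open>M i\<close> and \<open>N i\<close> off this
        line.\<close>
      have "polar (f i) p q \<noteq> 0"
      proof
        assume "polar (f i) p q = 0"
        then have "cp2.proj_line P Q \<subseteq> conic_points (\<Gamma> i)"
          unfolding p q \<Gamma>[OF i] by (rule proj_line_subset_conic_points[OF f_quad pq f0])
        with PQ have "cp2.proj_line P Q \<subseteq> conic_points C \<inter> conic_points (\<Gamma> i)"
          by blast
        then show False
          using fin[OF i] infinite_proj_line[OF pq] finite_subset unfolding p q by blast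
      qed
      then have "Z (m i) \<noteq> 0" "Z (n i) \<noteq> 0"
        using Z_nz[OF f_quad f0] mn[OF i] MN_PQ[OF i] by metis+
      then have "l c (m i) = 0" "l c (n i) = 0"
        using expand[OF c(2) c0] mn(5,6)[OF i] True by (metis add.left_neutral mult_eq_0_iff)+
      then show ?thesis
        unfolding mn(1,2)[OF i]
        using assms(9)[OF i] mn[OF i] by (intro proj_line_eq_kernel_line[OF l s]) auto
    qed
    have "M 1 \<in> kernel_line (l c)"
      using line[of 1] mn[of 1] cp2.span_mem_proj_line_iff[of "m 1" "m 1" "n 1"]
      by (simp add: vec.span_base)
    moreover have "M 1 \<in> CP2"
      using mn[of 1] by simp
    ultimately show ?thesis
      using line PQ unfolding concurrent_lines_def by blast
  next
    case c_pq: False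
    show ?thesis
    proof (cases "C \<in> F")
      \<comment> \<open>\<open>C\<close> and each \<open>\<Gamma> i\<close> are distinct members of
        the pencil, so \<open>M i\<close> and \<open>N i\<close> are always the two remaining base
        points, possibly in the other order.\<close>
      case True
      have "C \<noteq> \<Gamma> i" if "i \<in> {1..4}" for i
        using fin[OF that] infinite_conic_points[OF c(2) pq c0] unfolding c(1) by auto
      then have "{M i, N i} = base_points F - {P, Q}" if "i \<in> {1..4}" for i
        using assms(10)[OF that] base_points_eq_Int[OF F quad True assms(2)[OF that]] that by blast
      then have eq: "{M i, N i} = {M 1, N 1}" if "i \<in> {1..4}" for i
        using that by simp
      have "M 1 \<in> cp2.proj_line (M i) (N i)" if i: "i \<in> {1..4}" for i
      proof -
        have "M 1 = M i \<or> M 1 = N i"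
          using eq[OF i] by blast
        moreover have "M i \<in> cp2.proj_line (M i) (N i)" "N i \<in> cp2.proj_line (M i) (N i)"
          using mn[OF i] by (simp_all add: cp2.span_mem_proj_line_iff vec.span_base)
        ultimately show ?thesis by metis
      qed
      moreover have "M 1 \<in> CP2"
        using mn[of 1] by simp
      ultimately show ?thesis
        using True unfolding concurrent_lines_def by blast
    next
      case C_F: False
      \<comment> \<open>\<open>a - k a * c\<close> vanishes on the line \<open>PQ\<close>, hence is the product of \<open>Z\<close> with a linear form \<open>h a\<close>.\<close>
      define k where "k a = polar a p q / polar c p q" for a
      define h where "h a w = l a w - k a * l c w" for a w
      have h_lin: "linear_form (h a)" for a
        using linear_form_combination[OF l l, of 1 a "- k a" c] by (simp add: h_def[abs_def])
      have split: "a w = k a * c w + Z w * h a w"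
        if "a \<in> quadratic_forms" "a p = 0" "a q = 0" for a w
      proof -
        have "k a * polar c p q = polar a p q"
          using c_pq by (simp add: k_def)
        then have "a w = k a * (X w * Y w * polar c p q) + Z w * l a w"
          using expand[OF that, of w] by (simp add: mult_ac)
        then show ?thesis
          unfolding expand[OF c(2) c0, of w] h_def by (simp add: algebra_simps)
      qed
      \<comment> \<open>All constructions are linear in the form. Hence \<open>h (f i)\<close> has
        in the pencil generated by \<open>h u\<close> and \<open>h v\<close> the same coordinate
        \<open>t i\<close> as \<open>\<Gamma> i\<close> has in \<open>F\<close>.\<close>
      have "polar (f i) a b = t i * polar u a b + polar v a b" for i a b
        by (simp add: polar_def f_apply algebra_simps)
      then have "k (f i) = t i * k u + k v" "l (f i) w = t i * l u w + l v w" for i w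
        by (simp_all add: k_def l_def f_apply add_divide_distrib algebra_simps)
      then have h_f: "h (f i) w = t i * h u w + h v w" for i w
        by (simp add: h_def algebra_simps)
      \<comment> \<open>A relation between \<open>h u\<close> and \<open>h v\<close> makes
        \<open>x u + y v\<close> a multiple of \<open>c\<close>; it is nonzero because
        \<open>u\<close> and \<open>v\<close> are independent, so \<open>C\<close> would lie in
        \<open>F\<close>.\<close>
      have ind: "x = 0 \<and> y = 0" if xy: "\<forall>w. x * h u w + y * h v w = 0" for x y
      proof (rule ccontr)
        assume nz: "\<not> (x = 0 \<and> y = 0)"
        define s where "s = x * k u + y * k v"
        define a where "a = (\<lambda>w. x * u w) + (\<lambda>w. y * v w)"
        have a_span: "a \<in> qf.span {u, v}"
          unfolding a_def using u v by (intro qf.span_add qf.span_scale)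
        have a_nz: "a \<noteq> 0"
          using qf.independent_pair_coeffs[OF uv(1,2), of x y] nz unfolding a_def by blast
        have "a w = s * c w" for w
        proof -
          have "a w = s * c w + Z w * (x * h u w + y * h v w)"
            unfolding a_def plus_fun_apply split[OF u_quad uv0(1,2), of w] split[OF v_quad uv0(3,4), of w]
            by (simp add: s_def algebra_simps)
          then show ?thesis
            using xy by simp
        qed
        then have a: "a = (\<lambda>w. s * c w)" by blast
        then have "s \<noteq> 0"
          using a_nz by (auto simp: fun_eq_iff)
        then have "qf.span {a} = C"
          unfolding a c(1) by (rule qf.span_singleton_scale)
        then show False
          using C_F a_span a_nz unfolding F by blast
      qed
      have line: "cp2.proj_line (M i) (N i) = kernel_line (\<lambda>w. t i * h u w + h v w)"
        if i: "i \<in> {1..4}" for i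
      proof -
        \<comment> \<open>At \<open>M i\<close> and \<open>N i\<close> both \<open>f i\<close> and
          \<open>c\<close> vanish while \<open>Z\<close> does not, so the splitting of
          \<open>f i\<close> leaves \<open>h (f i) = 0\<close>.\<close>
        have "Z (m i) \<noteq> 0" "Z (n i) \<noteq> 0"
          using Z_nz[OF c(2) c0 c_pq] mn[OF i] MN_PQ[OF i] by metis+
        then have zero: "h (f i) (m i) = 0" "h (f i) (n i) = 0"
          using split[OF f_quad f0, of i] mn(5-8)[OF i] by (metis add.left_neutral mult_eq_0_iff)+
        obtain s where "h (f i) s \<noteq> 0"
          using ind[of "t i" 1] by (auto simp: h_f)
        from proj_line_eq_kernel_line[OF h_lin this _ zero(1) _ zero(2)]
        have "cp2.proj_line (M i) (N i) = kernel_line (h (f i))"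
          using assms(9)[OF i] mn[OF i] by simp
        then show ?thesis
          by (simp add: h_f[abs_def])
      qed
      \<comment> \<open>The common zero of \<open>h u\<close> and \<open>h v\<close> spans the point
        where all the lines meet.\<close>
      obtain z where z: "z \<noteq> 0" "h u z = 0" "h v z = 0"
        using biorthogonal_vectors[OF h_lin h_lin ind] by metis
      have "vec.span {z} \<in> kernel_line (\<lambda>w. t i * h u w + h v w)" for i
        using z unfolding kernel_line_def by auto
      then have "concurrent_lines {1..4} (\<lambda>i. cp2.proj_line (M i) (N i))"
        unfolding concurrent_lines_def using line z(1) cp2.span_mem_proj_space_UNIV_iff by metis
      \<comment> \<open>Both cross ratios are the same expression in the \<open>t i\<close>.\<close>
      moreover have "qf.cross_ratio (\<Gamma> 1) (\<Gamma> 2) (\<Gamma> 3) (\<Gamma> 4) =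
          ((t 1 - t 3) * (t 2 - t 4)) / ((t 2 - t 3) * (t 1 - t 4))"
        using qf.cross_ratio_eq[OF uv(1,2)] by (simp add: \<Gamma>_span)
      ultimately show ?thesis
        using lines_cross_ratio_kernel_lines[OF h_lin h_lin ind] by (simp add: line)
    qed
  qed
qed

end
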